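(* For all integers $m\ge0$ and $n\ge1$, $$B_n^{(2m+2)}(m+1)=\sum_{s=1}^n \frac{(2m+2)!}{(2m+2-s)!}\,Y_{n,s}\big(B_1(1/2),B_2(1/2),\dots,B_{n-s+1}(1/2)\big),$$ where terms with $s>2m+2$ are read as $0$ (i.e. $1/(2m+2-s)!=0$).
   Context: $Y_{n,k}$ are the incomplete (partial) Bell polynomials $$Y_{n,k}(x_{1},\dots ,x_{n-k+1})=\sum \frac{n!}{j_{1}!j_{2}!\cdots j_{n-k+1}!}\left(\frac{x_1}{1!}\right)^{j_{1}}\cdots\left(\frac{x_{n-k+1}}{(n-k+1)!}\right)^{j_{n-k+1}},$$ the sum being over non-negative integers $j_1,\dots,j_{n-k+1}$ with $\sum_i j_i=k$ and $\sum_i i\,j_i=n$. The Bernoulli polynomials $B_n(t)$ are defined by $\frac{x e^{tx}}{e^x-1}=\sum_{n\ge0}\frac{B_n(t)}{n!}x^n$, and for an integer $r\ge0$ and real $t$ the generalized Bernoulli polynomials $B_n^{(r)}(t)$ by $\frac{x^r}{(e^x-1)^r}e^{tx}=\sum_{n\ge0} \frac{B_n^{(r)}(t)}{n!}x^n$, for $|x|<2\pi$. *)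

theory Defs
  imports "HOL-Complex_Analysis.Complex_Analysis"
begin

text \<open>
  The quotients below are exact: the power series \<open>fps_exp 1 - 1\<close> has subdegree 1, so its
  \<open>r\<close>-th power divides \<open>fps_X ^ r\<close>. That these formal definitions agree with the convergent
  expansions for \<open>\<bar>x\<bar> < 2 * pi\<close> is proved in \<open>gen_bernpoly_sums\<close> and \<open>bernpoly_sums\<close>.
\<close>

definition bernpoly :: "nat \<Rightarrow> real \<Rightarrow> real" where
  "bernpoly n t = fact n * fps_nth (fps_X * fps_exp t / (fps_exp 1 - 1)) n"

definition gen_bernpoly :: "nat \<Rightarrow> nat \<Rightarrow> real \<Rightarrow> real" where
  "gen_bernpoly r n t = fact n * fps_nth (fps_X ^ r / (fps_exp 1 - 1) ^ r * fps_exp t) n"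

text \<open>
  Only the values \<open>x 1, \<dots>, x (n - k + 1)\<close> of the argument sequence are used; an index tuple
  \<open>(j\<^sub>1, \<dots>, j\<^sub>n\<^sub>-\<^sub>k\<^sub>+\<^sub>1)\<close> is an extensional function on \<open>{1..n - k + 1}\<close>. The intended range is
  \<open>k \<le> n\<close>; for \<open>k > n\<close> the index set is empty and the value is 0.
\<close>

definition bell_indices :: "nat \<Rightarrow> nat \<Rightarrow> (nat \<Rightarrow> nat) set" where
  "bell_indices n k =
     {j \<in> {1..n - k + 1} \<rightarrow>\<^sub>E UNIV.
        (\<Sum>i=1..n - k + 1. j i) = k \<and> (\<Sum>i=1..n - k + 1. i * j i) = n}"

definition partial_bell :: "nat \<Rightarrow> nat \<Rightarrow> (nat \<Rightarrow> real) \<Rightarrow> real" where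
  "partial_bell n k x =
     (\<Sum>j\<in>bell_indices n k.
        fact n / (\<Prod>i=1..n - k + 1. fact (j i)) * (\<Prod>i=1..n - k + 1. (x i / fact i) ^ j i))"

text \<open>The sum above is a genuine finite sum.\<close>

lemma finite_bell_indices: "finite (bell_indices n k)"
proof (rule finite_subset)
  show "bell_indices n k \<subseteq> {1..n - k + 1} \<rightarrow>\<^sub>E {..k}"
  proof
    fix j assume j: "j \<in> bell_indices n k"
    have "j i \<le> k" if "i \<in> {1..n - k + 1}" for i
      using j that member_le_sum[of i "{1..n - k + 1}" j] by (auto simp: bell_indices_def)
    thus "j \<in> {1..n - k + 1} \<rightarrow>\<^sub>E {..k}"
      using j by (auto simp: bell_indices_def PiE_iff)
  qed
qed (auto intro: finite_PiE)

lemma subdegree_fps_exp_minus_1: "subdegree (fps_exp 1 - 1 :: 'a :: field_char_0 fps) = 1"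
  by (rule subdegreeI) auto

lemma fps_exp_minus_1_nonzero: "fps_exp 1 - 1 \<noteq> (0 :: 'a :: field_char_0 fps)"
  using subdegree_fps_exp_minus_1 by (metis subdegree_0 zero_neq_one)

lemma fps_exp_minus_1_power_dvd:
  "(fps_exp 1 - 1 :: 'a :: field_char_0 fps) ^ r dvd fps_X ^ r"
proof (rule dvd_power_same)
  show "fps_exp 1 - 1 dvd (fps_X :: 'a fps)"
    unfolding fps_dvd_iff[OF fps_exp_minus_1_nonzero fps_X_neq_zero] subdegree_fps_exp_minus_1
    by simp
qed

lemma bernpoly_conv_gen_bernpoly: "bernpoly n t = gen_bernpoly 1 n t"
proof -
  have "(fps_exp 1 - 1 :: real fps) dvd fps_X"
    using fps_exp_minus_1_power_dvd[of 1] by simp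
  thus ?thesis
    by (simp add: bernpoly_def gen_bernpoly_def div_mult_swap mult.commute)
qed

definition fps_complex :: "real fps \<Rightarrow> complex fps" where
  "fps_complex F = Abs_fps (\<lambda>n. complex_of_real (fps_nth F n))"

lemma fps_complex_mult: "fps_complex (F * G) = fps_complex F * fps_complex G"
  by (rule fps_ext) (simp add: fps_complex_def fps_mult_nth)

lemma fps_complex_1: "fps_complex 1 = 1"
  by (rule fps_ext) (simp add: fps_complex_def)

lemma fps_complex_power: "fps_complex (F ^ n) = fps_complex F ^ n"
  by (induction n) (simp_all add: fps_complex_mult fps_complex_1)

lemma fps_complex_diff: "fps_complex (F - G) = fps_complex F - fps_complex G"
  by (rule fps_ext) (simp add: fps_complex_def)

lemma fps_complex_X: "fps_complex fps_X = fps_X"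
  by (rule fps_ext) (simp add: fps_complex_def fps_X_def)

lemma fps_complex_exp: "fps_complex (fps_exp t) = fps_exp (complex_of_real t)"
  by (rule fps_ext) (simp add: fps_complex_def)

lemma gen_bernpoly_sums:
  fixes x t :: real
  assumes "x \<noteq> 0" "\<bar>x\<bar> < 2 * pi"
  shows "(\<lambda>n. gen_bernpoly r n t / fact n * x ^ n) sums (x ^ r / (exp x - 1) ^ r * exp (t * x))"
proof -
  define E where "E = (fps_exp 1 - 1 :: complex fps)"
  define A where "A = fps_X ^ r / (fps_exp 1 - 1) ^ r * fps_exp t"
  define q where "q = (\<lambda>z::complex. if z = 0 then 1 else z / (exp z - 1))"
  define f where "f = (\<lambda>z. q z ^ r * exp (of_real t * z))"
  have E0: "E \<noteq> 0" and sE: "subdegree E = 1"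
    unfolding E_def by (rule fps_exp_minus_1_nonzero, rule subdegree_fps_exp_minus_1)
  have q_exp: "q has_fps_expansion (fps_X / E)"
    unfolding q_def
  proof (rule has_fps_expansion_divide)
    show "(\<lambda>z. exp z - 1) has_fps_expansion E"
      unfolding E_def by (intro fps_expansion_intros)
  qed (use E0 sE in \<open>auto simp: E_def fps_expansion_intros\<close>)
  have f_exp: "f has_fps_expansion ((fps_X / E) ^ r * fps_exp (of_real t))"
    unfolding f_def by (intro fps_expansion_intros q_exp)
  have "A * (fps_exp 1 - 1) ^ r = fps_X ^ r * fps_exp t"
    using fps_exp_minus_1_power_dvd[of r, where 'a = real] unfolding A_def
    by (metis (no_types) dvd_div_mult_self mult.assoc mult.commute)
  hence "fps_complex (A * (fps_exp 1 - 1) ^ r) = fps_complex (fps_X ^ r * fps_exp t)"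
    by simp
  hence "fps_complex A * E ^ r = fps_X ^ r * fps_exp (of_real t)"
    by (simp add: fps_complex_mult fps_complex_power fps_complex_diff fps_complex_1
          fps_complex_X fps_complex_exp E_def)
  also have "fps_X = (fps_X / E) * E"
    using fps_exp_minus_1_power_dvd[of 1, where 'a = complex] by (simp add: E_def)
  hence "fps_X ^ r = (fps_X / E) ^ r * E ^ r"
    by (metis power_mult_distrib)
  finally have "fps_complex A * E ^ r = ((fps_X / E) ^ r * fps_exp (of_real t)) * E ^ r"
    by (simp add: mult_ac)
  hence A: "fps_complex A = (fps_X / E) ^ r * fps_exp (of_real t)"
    using E0 by simp
  have nz: "exp z \<noteq> 1" if "z \<noteq> 0" "norm z < 2 * pi" for z :: complex
  proof
    assume "exp z = 1"
    then obtain n :: int where n: "Re z = 0" "Im z = of_int (2 * n) * pi"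
      by (auto simp: exp_eq_1)
    hence "norm z = 2 * pi * \<bar>of_int n\<bar>"
      by (simp add: cmod_def abs_mult)
    with that(2) have "\<bar>real_of_int n\<bar> < 1"
      by simp
    hence "n = 0" by linarith
    with n that(1) show False by (simp add: complex_eq_iff)
  qed
  have q_holo: "q holomorphic_on ball 0 (2 * pi)"
  proof -
    from q_exp have "q analytic_on {0}"
      by (rule has_fps_expansion_imp_analytic_0)
    then obtain e where e: "e > 0" "q holomorphic_on ball 0 e"
      by (auto simp: analytic_at_ball)
    have "(\<lambda>z. z / (exp z - 1)) holomorphic_on ball 0 (2 * pi) - {0}"
      by (intro holomorphic_intros) (use nz in auto)
    hence "q holomorphic_on ball 0 (2 * pi) - {0}"
      by (rule holomorphic_transform) (auto simp: q_def)
    hence "q holomorphic_on (ball 0 e \<union> (ball 0 (2 * pi) - {0}))"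
      by (intro holomorphic_on_Un e) auto
    thus ?thesis
      by (rule holomorphic_on_subset) (use e in auto)
  qed
  have f_holo: "f holomorphic_on eball 0 (ereal (2 * pi))"
    unfolding f_def using q_holo by (auto intro!: holomorphic_intros)
  have "(\<lambda>n. fps_nth (fps_complex A) n * of_real x ^ n) sums f (of_real x)"
    unfolding A by (rule has_fps_expansion_imp_sums_complex[OF f_exp f_holo]) (use assms in auto)
  also have "f (of_real x) = of_real (x ^ r / (exp x - 1) ^ r * exp (t * x))"
    using assms by (simp add: f_def q_def exp_of_real [symmetric] power_divide)
  also have "(\<lambda>n. fps_nth (fps_complex A) n * of_real x ^ n) =
             (\<lambda>n. complex_of_real (gen_bernpoly r n t / fact n * x ^ n))"
    by (simp add: fps_complex_def gen_bernpoly_def A_def)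
  finally show ?thesis
    by (simp only: sums_of_real_iff)
qed

lemma bernpoly_sums:
  fixes x t :: real
  assumes "x \<noteq> 0" "\<bar>x\<bar> < 2 * pi"
  shows "(\<lambda>n. bernpoly n t / fact n * x ^ n) sums (x * exp (t * x) / (exp x - 1))"
  using gen_bernpoly_sums[OF assms, of 1 t] by (simp add: bernpoly_conv_gen_bernpoly)

end

theory Submission
  imports Defs
begin

text \<open>
  Let \<open>F = x e\<^sup>t\<^sup>x / (e\<^sup>x - 1)\<close> be the exponential generating function of the Bernoulli polynomials
  at \<open>t\<close>. Its \<open>r\<close>-th power is \<open>x\<^sup>r e\<^sup>r\<^sup>t\<^sup>x / (e\<^sup>x - 1)\<^sup>r\<close>, which generates the generalized Bernoulli
  polynomials of order \<open>r\<close> at \<open>r t\<close> (\<open>gen_bernpoly_conv_power\<close>); for \<open>t = 1/2\<close> and \<open>r = 2m + 2\<close> that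
  point is \<open>m + 1\<close>. On the other hand \<open>F = 1 + G\<close> where \<open>G\<close> has no constant term, so the binomial
  theorem gives \<open>F\<^sup>r = \<Sum>\<^sub>s (r choose s) G\<^sup>s\<close>. The partial Bell polynomials are exactly the
  coefficients of the powers of such a series: \<open>n! [x\<^sup>n] G\<^sup>s = s! Y\<^sub>n\<^sub>,\<^sub>s\<close> (\<open>fps_nth_egf_power\<close>). The
  factor \<open>(r choose s) s! = r! / (r - s)!\<close> is the one in the claim, and only \<open>1 \<le> s \<le> n\<close>
  contributes because \<open>G\<^sup>0 = 1\<close> and \<open>G\<^sup>s\<close> has no terms below degree \<open>s\<close>.

  The coefficient formula for \<open>G\<^sup>s\<close> is the multinomial theorem applied to a truncation of \<open>G\<close>.
  Up to the factor \<open>n!\<close>, the sum in the definition of \<open>partial_bell\<close> is a sum of products of divided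
  powers \<open>y\<^sup>j / j!\<close>, and in this normalization the multinomial theorem is just the iterated
  addition law \<open>divided_power_sum\<close>, with no quotients of factorials left.
\<close>

section \<open>Powers of exponential generating functions\<close>

definition compositions_on :: "'i set \<Rightarrow> nat \<Rightarrow> ('i \<Rightarrow> nat) set" where
  "compositions_on I k = {j \<in> I \<rightarrow>\<^sub>E UNIV. (\<Sum>i\<in>I. j i) = k}"

lemma finite_compositions_on:
  assumes "finite I"
  shows "finite (compositions_on I k)"
proof (rule finite_subset)
  show "compositions_on I k \<subseteq> I \<rightarrow>\<^sub>E {..k}"
  proof
    fix j assume j: "j \<in> compositions_on I k"
    hence "j i \<le> k" if "i \<in> I" for i
      using assms that member_le_sum[of i I j] by (auto simp: compositions_on_def)
    with j show "j \<in> I \<rightarrow>\<^sub>E {..k}"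
      by (auto simp: compositions_on_def PiE_iff)
  qed
qed (use assms in \<open>auto intro: finite_PiE\<close>)

text \<open>
  A multinomial theorem that rests on the addition law of \<open>\<gamma> k y = y\<^sup>k / k!\<close>. Splitting off
  the value at one index identifies a tuple of sum \<open>k\<close> on the larger index set with a pair consisting
  of that value \<open>a \<le> k\<close> and a tuple of sum \<open>k - a\<close> on the smaller one.
\<close>

lemma divided_power_sum:
  fixes \<gamma> :: "nat \<Rightarrow> 'b :: comm_monoid_add \<Rightarrow> 'a :: comm_semiring_1"
  assumes "finite I"
  assumes zero: "\<And>k. \<gamma> k 0 = (if k = 0 then 1 else 0)"
  assumes add: "\<And>k x y. \<gamma> k (x + y) = (\<Sum>a\<le>k. \<gamma> a x * \<gamma> (k - a) y)"
  shows "\<gamma> k (\<Sum>i\<in>I. y i) = (\<Sum>j\<in>compositions_on I k. \<Prod>i\<in>I. \<gamma> (j i) (y i))"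
  using \<open>finite I\<close>
proof (induction I arbitrary: k rule: finite_induct)
  case empty
  have "compositions_on {} k = (if k = 0 then {\<lambda>_. undefined} else {} :: ('c \<Rightarrow> nat) set)"
    by (auto simp: compositions_on_def)
  thus ?case by (simp add: zero)
next
  case (insert p I)
  have sum_upd: "(\<Sum>i\<in>I. (if i = p then a else f i)) = (\<Sum>i\<in>I. f i)"
    for a and f :: "'c \<Rightarrow> nat"
    using insert by (intro sum.cong) auto
  have "\<gamma> k (\<Sum>i\<in>insert p I. y i) =
          (\<Sum>a\<le>k. \<Sum>j\<in>compositions_on I (k - a). \<gamma> a (y p) * (\<Prod>i\<in>I. \<gamma> (j i) (y i)))"
    using insert by (simp add: add sum_distrib_left)
  also have "\<dots> = (\<Sum>(a, j)\<in>(SIGMA a:{..k}. compositions_on I (k - a)).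
                   \<gamma> a (y p) * (\<Prod>i\<in>I. \<gamma> (j i) (y i)))"
    using insert by (subst sum.Sigma) (auto simp: finite_compositions_on)
  also have "\<dots> = (\<Sum>j\<in>compositions_on (insert p I) k. \<Prod>i\<in>insert p I. \<gamma> (j i) (y i))"
  proof (rule sum.reindex_bij_witness[where i = "\<lambda>j. (j p, j(p := undefined))"
                                        and j = "\<lambda>(a, j). j(p := a)"], goal_cases)
    case (1 u)
    thus ?case using insert by (auto simp: compositions_on_def PiE_iff extensional_def)
  next
    case (2 u)
    with sum_upd show ?case using insert
      by (auto simp: compositions_on_def PiE_iff extensional_def fun_upd_def)
  next
    case (3 j)
    thus ?case by simp
  next
    case (4 j)
    with sum_upd show ?case using insert
      by (auto simp: compositions_on_def PiE_iff extensional_def fun_upd_def)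
  next
    case (5 u)
    obtain a j where u: "u = (a, j)" by (cases u)
    have "(\<Prod>i\<in>I. \<gamma> ((j(p := a)) i) (y i)) = (\<Prod>i\<in>I. \<gamma> (j i) (y i))"
      using insert by (intro prod.cong) auto
    thus ?case using insert by (simp add: u)
  qed
  finally show ?case .
qed

lemma fps_divided_power_sum:
  fixes y :: "'i \<Rightarrow> 'a :: field_char_0 fps"
  assumes "finite I"
  shows "fps_const (1 / fact k) * (\<Sum>i\<in>I. y i) ^ k =
         (\<Sum>j\<in>compositions_on I k. \<Prod>i\<in>I. fps_const (1 / fact (j i)) * y i ^ j i)"
proof (rule divided_power_sum[OF assms, where \<gamma> = "\<lambda>k f. fps_const (1 / fact k) * f ^ k"])
  fix k :: nat and f g :: "'a fps"
  have "fps_const (1 / fact k) * (f + g) ^ k =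
          (\<Sum>a\<le>k. fps_const (1 / fact k * of_nat (k choose a)) * (f ^ a * g ^ (k - a)))"
    unfolding fps_const_mult [symmetric] fps_of_nat
    by (simp add: binomial_ring sum_distrib_left mult_ac)
  also have "\<dots> = (\<Sum>a\<le>k. (fps_const (1 / fact a) * f ^ a) *
                            (fps_const (1 / fact (k - a)) * g ^ (k - a)))"
    by (intro sum.cong) (simp_all add: binomial_fact mult_ac flip: fps_const_mult)
  finally show "fps_const (1 / fact k) * (f + g) ^ k = \<dots>" .
qed auto

text \<open>
  The exponential generating function of \<open>x 1, x 2, \<dots>\<close>. Forcing the constant term to be 0, whatever
  \<open>x 0\<close> is, keeps its \<open>k\<close>-th power free of terms below
  degree \<open>k\<close>.
\<close>

definition egf_pos :: "(nat \<Rightarrow> real) \<Rightarrow> real fps" where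
  "egf_pos x = Abs_fps (\<lambda>i. if i = 0 then 0 else x i / fact i)"

lemma egf_pos_nth_0 [simp]: "fps_nth (egf_pos x) 0 = 0"
  by (simp add: egf_pos_def)

lemma fps_nth_mult_eq_0:
  fixes D S :: "real fps"
  assumes "\<And>i. i < d \<Longrightarrow> fps_nth D i = 0" "\<And>i. i < l \<Longrightarrow> fps_nth S i = 0" "n < d + l"
  shows "fps_nth (D * S) n = 0"
  unfolding fps_mult_nth
proof (rule sum.neutral, rule ballI)
  fix i assume "i \<in> {0..n}"
  thus "fps_nth D i * fps_nth S (n - i) = 0"
    using assms by (cases "i < d") auto
qed

lemma prod_fps_monomials:
  fixes u v :: "nat \<Rightarrow> real" and j :: "nat \<Rightarrow> nat"
  assumes "finite A"
  shows "(\<Prod>i\<in>A. fps_const (u i) * (fps_const (v i) * fps_X ^ i) ^ j i) =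
         fps_const ((\<Prod>i\<in>A. u i) * (\<Prod>i\<in>A. v i ^ j i)) * fps_X ^ (\<Sum>i\<in>A. i * j i)"
  using assms
proof (induction A rule: finite_induct)
  case (insert p A)
  have single: "fps_const (u p) * (fps_const (v p) * fps_X ^ p) ^ j p =
        fps_const (u p * v p ^ j p) * fps_X ^ (p * j p)"
    unfolding fps_const_mult [symmetric] power_mult_distrib power_mult fps_const_power mult.assoc
    by (rule refl)
  have collect: "(fps_const c * P) * (fps_const d * Q) = fps_const (c * d) * (P * Q)"
    for c d :: real and P Q :: "real fps"
    by (simp add: mult_ac flip: fps_const_mult)
  show ?case
    unfolding prod.insert[OF insert.hyps] sum.insert[OF insert.hyps] insert.IH single collect
      power_add
    by (simp only: mult_ac)
qed simp

text \<open>
  The series \<open>G\<^sup>k / k!\<close> is the exponential generating function of the partial Bell polynomials,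
  where \<open>G\<close> is that of the arguments. Their definition involves only the arguments up to
  \<open>n - k + 1\<close>, so \<open>G\<close> is first cut off there; the divided-power form of the multinomial theorem
  then expands the finite sum into monomials, among which those of degree \<open>n\<close> are indexed by \<open>bell_indices n k\<close>.
\<close>

lemma fps_nth_egf_power:
  "fact n * fps_nth (egf_pos x ^ k) n = fact k * partial_bell n k x"
proof -
  define M where "M = n - k + 1"
  define H where "H = (\<Sum>i\<in>{1..M}. fps_const (x i / fact i) * fps_X ^ i)"
  define c where "c = (\<lambda>j. (\<Prod>i=1..M. 1 / fact (j i)) * (\<Prod>i=1..M. (x i / fact i) ^ j i))"
  have H_nth: "fps_nth H i = (if 1 \<le> i \<and> i \<le> M then x i / fact i else 0)" for i
    by (auto simp: H_def fps_sum_nth if_distrib cong: if_cong)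
  \<comment> \<open>Terms of degree above \<open>n - k + 1\<close> meet at least \<open>k - 1\<close> further factors of positive degree,
     so the truncation does not change the coefficient of degree \<open>n\<close>.\<close>
  have trunc: "fps_nth (egf_pos x ^ k) n = fps_nth (H ^ k) n"
  proof (cases k)
    case (Suc l)
    define S where "S = (\<Sum>i<Suc l. H ^ (l - i) * egf_pos x ^ i)"
    have "egf_pos x ^ k - H ^ k = (egf_pos x - H) * S"
      unfolding Suc S_def by (simp add: power_diff_sumr2 del: power_Suc)
    moreover have "fps_nth ((egf_pos x - H) * S) n = 0"
    proof (rule fps_nth_mult_eq_0[where d = "Suc M" and l = l])
      show "fps_nth (egf_pos x - H) i = 0" if "i < Suc M" for i
        using that by (auto simp: H_nth egf_pos_def)
      show "fps_nth S i = 0" if "i < l" for i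
      proof -
        have "fps_nth (H ^ (l - q) * egf_pos x ^ q) i = 0" if "q < Suc l" for q
          by (rule fps_nth_mult_eq_0[where d = "l - q" and l = q])
             (use that \<open>i < l\<close> in \<open>auto simp: startsby_zero_power_prefix H_nth\<close>)
        thus ?thesis by (simp add: S_def fps_sum_nth del: sum.lessThan_Suc)
      qed
      show "n < Suc M + l" by (simp add: M_def Suc)
    qed
    ultimately show ?thesis by (metis eq_iff_diff_eq_0 fps_sub_nth)
  qed simp
  have "fps_nth (H ^ k) n / fact k = fps_nth (fps_const (1 / fact k) * H ^ k) n"
    by simp
  also have "fps_const (1 / fact k) * H ^ k =
      (\<Sum>j\<in>compositions_on {1..M} k. fps_const (c j) * fps_X ^ (\<Sum>i=1..M. i * j i))"
    unfolding H_def by (simp only: fps_divided_power_sum prod_fps_monomials finite_atLeastAtMost c_def)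
  also have "fps_nth \<dots> n =
      (\<Sum>j\<in>compositions_on {1..M} k. if (\<Sum>i=1..M. i * j i) = n then c j else 0)"
    unfolding fps_sum_nth by (intro sum.cong) auto
  also have "\<dots> = (\<Sum>j\<in>bell_indices n k. c j)"
  proof -
    have "bell_indices n k = {j \<in> compositions_on {1..M} k. (\<Sum>i=1..M. i * j i) = n}"
      by (auto simp: bell_indices_def compositions_on_def M_def)
    thus ?thesis by (simp add: sum.inter_filter finite_compositions_on)
  qed
  also have "fact n * \<dots> = partial_bell n k x"
    by (simp add: partial_bell_def c_def M_def sum_distrib_left prod_dividef)
  finally show ?thesis by (simp add: trunc field_simps)
qed

section \<open>Powers of the Bernoulli generating function\<close>

text \<open>
  Raising \<open>x e\<^sup>t\<^sup>x / (e\<^sup>x - 1)\<close> to the power \<open>r\<close> multiplies the exponent by \<open>r\<close>, which is why the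
  argument is \<open>r t\<close>. Since the formal quotients are exact, the two sides can be compared after
  multiplication by \<open>(e\<^sup>x - 1)\<^sup>r\<close>.
\<close>

lemma gen_bernpoly_conv_power:
  "gen_bernpoly r n (real r * t) =
     fact n * fps_nth ((fps_X * fps_exp t / (fps_exp 1 - 1)) ^ r) n"
proof -
  define E where "E = (fps_exp 1 - 1 :: real fps)"
  have "E \<noteq> 0" unfolding E_def by (rule fps_exp_minus_1_nonzero)
  have dvd: "E ^ k dvd fps_X ^ k" for k
    unfolding E_def by (rule fps_exp_minus_1_power_dvd)
  have "(fps_X * fps_exp t / E) ^ r * E ^ r = (fps_X * fps_exp t / E * E) ^ r"
    by (simp add: power_mult_distrib)
  also have "fps_X * fps_exp t / E * E = fps_X * fps_exp t"
    using dvd[of 1] by (intro dvd_div_mult_self dvd_mult2) simp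
  also have "(fps_X * fps_exp t) ^ r = fps_X ^ r / E ^ r * fps_exp (real r * t) * E ^ r"
    using dvd_div_mult_self[OF dvd[of r]]
    by (metis fps_exp_power_mult mult.assoc mult.commute power_mult_distrib)
  finally have "(fps_X * fps_exp t / E) ^ r = fps_X ^ r / E ^ r * fps_exp (real r * t)"
    using \<open>E \<noteq> 0\<close> by simp
  thus ?thesis by (simp add: gen_bernpoly_def E_def)
qed

lemma bernpoly_egf:
  "fps_X * fps_exp t / (fps_exp 1 - 1) = 1 + egf_pos (\<lambda>i. bernpoly i t)"
proof (rule fps_ext)
  fix i
  \<comment> \<open>The divisor has no constant term, so the constant term of the quotient is read off from the
     coefficient of degree 1 in quotient times divisor.\<close>
  have "bernpoly 0 t = 1"
  proof -
    define E where "E = (fps_exp 1 - 1 :: real fps)"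
    have "E dvd fps_X * fps_exp t"
      using fps_exp_minus_1_power_dvd[of 1, where 'a = real] by (simp add: E_def)
    hence "fps_X * fps_exp t / E * E = fps_X * fps_exp t" by simp
    hence "fps_nth (fps_X * fps_exp t / E * E) 1 = fps_nth (fps_X * fps_exp t) 1" by simp
    thus ?thesis by (simp add: bernpoly_def E_def fps_mult_nth)
  qed
  thus "fps_nth (fps_X * fps_exp t / (fps_exp 1 - 1)) i =
        fps_nth (1 + egf_pos (\<lambda>i. bernpoly i t)) i"
    by (auto simp: egf_pos_def bernpoly_def)
qed

text \<open>
  The claim at a general order \<open>r\<close> and base point \<open>t\<close>. Both sides are \<open>n! [x\<^sup>n] (1 + G)\<^sup>r\<close>: the left
  side by \<open>gen_bernpoly_conv_power\<close>, the right side after binomial expansion. The binomial sum runs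
  over \<open>s \<le> r\<close> and the claimed one over \<open>1 \<le> s \<le> n\<close>; they agree because \<open>[x\<^sup>n] G\<^sup>s = 0\<close> for
  \<open>s = 0\<close> and for \<open>s > n\<close>, while the coefficient on the right is 0 for \<open>s > r\<close>.
\<close>

lemma gen_bernpoly_partial_bell:
  assumes "n \<ge> 1"
  shows "gen_bernpoly r n (real r * t) =
    (\<Sum>s=1..n. (if s \<le> r then fact r / fact (r - s) else 0) *
       partial_bell n s (\<lambda>i. bernpoly i t))"
proof -
  define G where "G = egf_pos (\<lambda>i. bernpoly i t)"
  have "gen_bernpoly r n (real r * t) = fact n * fps_nth ((G + 1) ^ r) n"
    by (simp add: gen_bernpoly_conv_power bernpoly_egf G_def add.commute)
  also have "\<dots> = (\<Sum>s\<le>r. real (r choose s) * (fact n * fps_nth (G ^ s) n))"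
    by (simp add: binomial_ring fps_sum_nth sum_distrib_left mult_ac flip: fps_of_nat)
  also have "\<dots> = (\<Sum>s=1..n. (if s \<le> r then fact r / fact (r - s) else 0) *
                      partial_bell n s (\<lambda>i. bernpoly i t))"
  proof (rule sum.mono_neutral_cong)
    show "real (r choose s) * (fact n * fps_nth (G ^ s) n) = 0" if "s \<in> {..r} - {1..n}" for s
    proof (cases "s = 0")
      case False
      hence "n < s" using that by auto
      thus ?thesis by (simp add: G_def startsby_zero_power_prefix)
    qed (use assms in auto)
    show "real (r choose s) * (fact n * fps_nth (G ^ s) n) =
            (if s \<le> r then fact r / fact (r - s) else 0) * partial_bell n s (\<lambda>i. bernpoly i t)"
      if "s \<in> {..r} \<inter> {1..n}" for s
      using that by (simp add: G_def fps_nth_egf_power binomial_fact)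
  qed auto
  finally show ?thesis .
qed

theorem proposition4p5:
  fixes m n :: nat
  assumes "n \<ge> 1"
  shows "gen_bernpoly (2 * m + 2) n (real m + 1) =
    (\<Sum>s=1..n. (if s \<le> 2 * m + 2 then fact (2 * m + 2) / fact (2 * m + 2 - s) else 0) *
       partial_bell n s (\<lambda>i. bernpoly i (1 / 2)))"
proof -
  have "real (2 * m + 2) * (1 / 2) = real m + 1" by simp
  thus ?thesis using gen_bernpoly_partial_bell[OF assms, of "2 * m + 2" "1 / 2"] by (simp only:)
qed

end
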